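(* Let $\Gamma$ be a relatively compact admissible subset of $\mathcal P$. Let $G=\langle\Gamma\rangle$. Then $J_{\ker}(G)=\emptyset$.
   Context: $\hat{\mathbb C}$ is the Riemann sphere with spherical distance $d$. $\mathcal P$ is the set of polynomial maps $\hat{\mathbb C}\to\hat{\mathbb C}$ of degree at least $2$, with the topology given by the metric $\kappa(f,g)=\sup_{z\in\hat{\mathbb C}}d(f(z),g(z))$. $\langle\Gamma\rangle$ is the semigroup generated by $\Gamma$ under composition. For a semigroup $G$ of non-constant rational maps, $F(G)$ is the set of $z\in\hat{\mathbb C}$ having a neighborhood on which $G$ is equicontinuous with respect to $d$; $J(G)=\hat{\mathbb C}\setminus F(G)$; $J_{\ker}(G)=\bigcap_{g\in G}g^{-1}(J(G))$. Let $\Lambda$ be a finite dimensional complex manifold. A family $\{g_\lambda\}_{\lambda\in\Lambda}$ of rational maps on $\hat{\mathbb C}$ is a holomorphic family of rational maps if the map $(z,\lambda)\in\hat{\mathbb C}\times\Lambda\mapsto g_\lambda(z)\in\hat{\mathbb C}$ is holomorphic on $\hat{\mathbb C}\times\Lambda$; it is a holomorphic family of polynomials if, in addition, each $g_\lambda$ is a polynomial. A subset $\mathcal Y$ of $\mathcal P$ is admissible if for each $z_0\in\mathbb C$ there exists a holomorphic family of polynomials $\{g_\lambda\}_{\lambda\in\Lambda}$ such that $\{g_\lambda\mid\lambda\in\Lambda\}\subset\mathcal Y$ and the map $\lambda\mapsto g_\lambda(z_0)$ is nonconstant in $\Lambda$.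
   Formalization: The complex manifolds Λ in the definition of admissible are taken to be connected (and second countable); with disconnected Λ the claim fails, e.g. Λ two points and Γ = {Mz(z−1), Mz(z−1)+1} with |M|>1, where 0 and 1 lie in J_ker(G). *)

theory Defs
  imports "HOL-Analysis.Analysis" "HOL-Computational_Algebra.Polynomial_Factorial"
begin

datatype riemann_sphere = Fin complex | Infty

text \<open>Inverse stereographic projection onto the unit sphere of \<open>\<complex> \<times> \<real>\<close>, with
  \<open>\<infinity>\<close> as the north pole.\<close>

fun stereo :: "riemann_sphere \<Rightarrow> complex \<times> real" where
  "stereo (Fin z) = ((2 / (1 + (cmod z)\<^sup>2)) *\<^sub>R z, ((cmod z)\<^sup>2 - 1) / ((cmod z)\<^sup>2 + 1))"
| "stereo Infty = (0, 1)"

lemma stereo_inner_self: "stereo p \<bullet> stereo p = 1"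
proof (cases p)
  case (Fin z)
  have pos: "1 + (cmod z)\<^sup>2 > 0" by (simp add: add_pos_nonneg)
  have "4 * (cmod z)\<^sup>2 + ((cmod z)\<^sup>2 - 1)\<^sup>2 = (1 + (cmod z)\<^sup>2)\<^sup>2"
    by (simp add: power2_eq_square algebra_simps)
  then have "(4 * (cmod z)\<^sup>2 + ((cmod z)\<^sup>2 - 1)\<^sup>2) / (1 + (cmod z)\<^sup>2)\<^sup>2 = 1"
    using pos by simp
  then show ?thesis using Fin
    by (simp add: inner_prod_def dot_square_norm power2_eq_square add_divide_distrib
        power_divide add.commute)
qed (simp add: inner_prod_def)

lemma norm_stereo: "norm (stereo p) = 1"
  by (simp add: norm_eq_sqrt_inner stereo_inner_self)

lemma inj_stereo: "inj stereo"
proof (rule injI)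
  fix p q assume eq: "stereo p = stereo q"
  have pos: "1 + (cmod z)\<^sup>2 > 0" for z by (simp add: add_pos_nonneg)
  have snd_Fin: "snd (stereo (Fin z)) = 1 - 2 / (1 + (cmod z)\<^sup>2)" for z
    using pos[of z] by (simp add: field_simps)
  show "p = q"
  proof (cases p; cases q)
    fix z w assume pq: "p = Fin z" "q = Fin w"
    have "2 / (1 + (cmod z)\<^sup>2) = 2 / (1 + (cmod w)\<^sup>2)"
      using eq pq snd_Fin[of z] snd_Fin[of w] by (metis add_diff_cancel_left diff_diff_eq2 diff_add_cancel)
    moreover have "(2 / (1 + (cmod z)\<^sup>2)) *\<^sub>R z = (2 / (1 + (cmod w)\<^sup>2)) *\<^sub>R w"
      using eq pq by simp
    ultimately have "(2 / (1 + (cmod z)\<^sup>2)) *\<^sub>R z = (2 / (1 + (cmod z)\<^sup>2)) *\<^sub>R w" by simp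
    moreover have "2 / (1 + (cmod z)\<^sup>2) \<noteq> 0" using pos[of z] by simp
    ultimately show ?thesis using pq by (metis scaleR_cancel_left)
  next
    fix z assume "p = Fin z" "q = Infty"
    then show ?thesis using eq snd_Fin[of z] pos[of z] by simp
  next
    fix w assume "p = Infty" "q = Fin w"
    then show ?thesis using eq snd_Fin[of w] pos[of w] by (metis diff_eq_eq diff_numeral_special(9) 
       divide_eq_0_iff eq_diff_eq less_irrefl snd_conv stereo.simps(2) zero_neq_numeral add.right_neutral add_left_cancel)
  qed simp
qed

lemma abs_stereo_inner_le: "\<bar>stereo p \<bullet> stereo q\<bar> \<le> 1"
  using Cauchy_Schwarz_ineq2[of "stereo p" "stereo q"] by (simp add: norm_stereo)

lemma stereo_inner_bounds: "- 1 \<le> stereo p \<bullet> stereo q" "stereo p \<bullet> stereo q \<le> 1"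
  using abs_stereo_inner_le[of p q] by auto

lemma arccos_inner_triangle:
  fixes u v w :: "'a::real_inner"
  assumes "norm u = 1" "norm v = 1" "norm w = 1"
  shows "arccos (u \<bullet> w) \<le> arccos (u \<bullet> v) + arccos (v \<bullet> w)"
proof -
  have uu: "u \<bullet> u = 1" "v \<bullet> v = 1" "w \<bullet> w = 1"
    using assms by (simp_all add: dot_square_norm)
  have b: "\<bar>u \<bullet> v\<bar> \<le> 1" "\<bar>v \<bullet> w\<bar> \<le> 1" "\<bar>u \<bullet> w\<bar> \<le> 1"
    using assms Cauchy_Schwarz_ineq2[of u v] Cauchy_Schwarz_ineq2[of v w]
      Cauchy_Schwarz_ineq2[of u w] by auto
  define a where "a = arccos (u \<bullet> v)"
  define c where "c = arccos (v \<bullet> w)"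
  have ac: "0 \<le> a" "0 \<le> c" using b by (auto simp: a_def c_def abs_le_iff intro!: arccos_lbound)
  have uw: "arccos (u \<bullet> w) \<le> pi" using b by (intro arccos_ubound) auto
  show ?thesis
  proof (cases "a + c \<le> pi")
    case True
    define x where "x = u - (u \<bullet> v) *\<^sub>R v"
    define y where "y = w - (v \<bullet> w) *\<^sub>R v"
    have xx: "norm x = sqrt (1 - (u \<bullet> v)\<^sup>2)"
      unfolding norm_eq_sqrt_inner x_def
      by (simp add: inner_diff_left inner_diff_right uu inner_commute power2_eq_square)
    have yy: "norm y = sqrt (1 - (v \<bullet> w)\<^sup>2)"
      unfolding norm_eq_sqrt_inner y_def
      by (simp add: inner_diff_left inner_diff_right uu inner_commute power2_eq_square)
    have "x \<bullet> y = u \<bullet> w - (u \<bullet> v) * (v \<bullet> w)"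
      unfolding x_def y_def by (simp add: inner_diff_left inner_diff_right uu inner_commute)
    moreover have "- (norm x * norm y) \<le> x \<bullet> y"
      using Cauchy_Schwarz_ineq2[of x y] by auto
    moreover have "sin a = norm x" "sin c = norm y"
      unfolding a_def c_def xx yy using b by (auto intro!: sin_arccos_abs)
    moreover have "cos a = u \<bullet> v" "cos c = v \<bullet> w"
      unfolding a_def c_def using b by (auto intro!: cos_arccos_abs)
    ultimately have "cos (a + c) \<le> u \<bullet> w" by (simp add: cos_add)
    then have "arccos (u \<bullet> w) \<le> arccos (cos (a + c))"
      using b by (intro arccos_le_arccos) auto
    also have "\<dots> = a + c" using True ac by (intro arccos_cos) auto
    finally show ?thesis by (simp add: a_def c_def)
  qed (use uw in \<open>simp add: a_def c_def\<close>)
qed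

text \<open>The distance is the great-circle distance on the unit sphere; the topology of
  \<^typ>\<open>riemann_sphere\<close> is the one it induces.\<close>

instantiation riemann_sphere :: metric_space
begin

definition dist_riemann_sphere :: "riemann_sphere \<Rightarrow> riemann_sphere \<Rightarrow> real" where
  "dist_riemann_sphere p q = arccos (stereo p \<bullet> stereo q)"

definition uniformity_riemann_sphere :: "(riemann_sphere \<times> riemann_sphere) filter" where
  "uniformity_riemann_sphere = (INF e\<in>{0<..}. principal {(x, y). dist x y < e})"

definition open_riemann_sphere :: "riemann_sphere set \<Rightarrow> bool" where
  "open_riemann_sphere U \<longleftrightarrow>
     (\<forall>x\<in>U. eventually (\<lambda>(x', y). x' = x \<longrightarrow> y \<in> U) uniformity)"

instance
proof
  fix p q r :: riemann_sphere
  have "p = q" if "stereo p \<bullet> stereo q = 1"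
  proof -
    have "(norm (stereo p - stereo q))\<^sup>2 = 0"
      using that by (simp add: power2_norm_eq_inner inner_diff_left inner_diff_right
          stereo_inner_self inner_commute)
    then show ?thesis using inj_stereo by (auto dest: injD)
  qed
  moreover have "stereo p \<bullet> stereo q = 1" if "arccos (stereo p \<bullet> stereo q) = 0"
    using that cos_arccos[OF stereo_inner_bounds[of p q]] by simp
  ultimately show "dist p q = 0 \<longleftrightarrow> p = q"
    by (auto simp: dist_riemann_sphere_def stereo_inner_self)
  show "dist p q \<le> dist p r + dist q r"
    using arccos_inner_triangle[of "stereo p" "stereo r" "stereo q"]
    by (simp add: dist_riemann_sphere_def norm_stereo inner_commute)
qed (simp_all add: uniformity_riemann_sphere_def open_riemann_sphere_def)

end

lemma dist_riemann_sphere_le_pi: "dist p q \<le> pi" for p q :: riemann_sphere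
  unfolding dist_riemann_sphere_def by (intro arccos_ubound stereo_inner_bounds)

text \<open>The map \<open>p / q\<close> for coprime \<open>p\<close>, \<open>q\<close>. The value at \<open>\<infinity>\<close> is read off from the
  homogenisations of \<open>p\<close> and \<open>q\<close> in the common degree \<open>max (degree p) (degree q)\<close>.\<close>

fun ratfun_map :: "complex poly \<Rightarrow> complex poly \<Rightarrow> riemann_sphere \<Rightarrow> riemann_sphere" where
  "ratfun_map p q (Fin z) = (if poly q z = 0 then Infty else Fin (poly p z / poly q z))"
| "ratfun_map p q Infty =
     (let d = max (degree p) (degree q)
      in if coeff q d = 0 then Infty else Fin (coeff p d / coeff q d))"

definition rational_map :: "(riemann_sphere \<Rightarrow> riemann_sphere) \<Rightarrow> bool" where
  "rational_map f \<longleftrightarrow> (\<exists>p q. coprime p q \<and> f = ratfun_map p q)"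

definition poly_map :: "complex poly \<Rightarrow> riemann_sphere \<Rightarrow> riemann_sphere" where
  "poly_map p = ratfun_map p 1"

lemma poly_map_simps:
  "poly_map p (Fin z) = Fin (poly p z)"
  "degree p \<ge> 1 \<Longrightarrow> poly_map p Infty = Infty"
  by (auto simp: poly_map_def Let_def coeff_eq_0)

definition polynomial_map :: "(riemann_sphere \<Rightarrow> riemann_sphere) \<Rightarrow> bool" where
  "polynomial_map f \<longleftrightarrow> (\<exists>p. f = poly_map p)"

definition \<P> :: "(riemann_sphere \<Rightarrow> riemann_sphere) set" where
  "\<P> = {poly_map p | p. degree p \<ge> 2}"

definition \<kappa> ::
  "(riemann_sphere \<Rightarrow> riemann_sphere) \<Rightarrow> (riemann_sphere \<Rightarrow> riemann_sphere) \<Rightarrow> real" where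
  "\<kappa> f g = (SUP z. dist (f z) (g z))"

lemma dist_le_\<kappa>: "dist (f z) (g z) \<le> \<kappa> f g"
  unfolding \<kappa>_def
  by (rule cSUP_upper) (auto intro!: bdd_aboveI[of _ pi] dist_riemann_sphere_le_pi)

lemma Metric_space_\<kappa>: "Metric_space A \<kappa>"
proof
  fix f g h
  show "0 \<le> \<kappa> f g"
    using dist_le_\<kappa>[of f undefined g] zero_le_dist order_trans by blast
  show "\<kappa> f g = \<kappa> g f"
    by (simp add: \<kappa>_def dist_commute)
  show "\<kappa> f g = 0 \<longleftrightarrow> f = g"
  proof
    assume "\<kappa> f g = 0"
    then have "dist (f z) (g z) = 0" for z using dist_le_\<kappa>[of f z g] by simp
    then show "f = g" by (auto simp: fun_eq_iff)
  qed (simp add: \<kappa>_def)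
  show "\<kappa> f h \<le> \<kappa> f g + \<kappa> g h"
    unfolding \<kappa>_def[of f h]
  proof (rule cSUP_least)
    fix z
    show "dist (f z) (h z) \<le> \<kappa> f g + \<kappa> g h"
      using dist_triangle[of "f z" "h z" "g z"] dist_le_\<kappa>[of f z g] dist_le_\<kappa>[of g z h]
      by linarith
  qed simp
qed

definition \<P>_topology :: "(riemann_sphere \<Rightarrow> riemann_sphere) topology" where
  "\<P>_topology = Metric_space.mtopology \<P> \<kappa>"

definition relatively_compactin :: "'a topology \<Rightarrow> 'a set \<Rightarrow> bool" where
  "relatively_compactin X S \<longleftrightarrow> S \<subseteq> topspace X \<and> compactin X (X closure_of S)"

inductive_set semigroup_generated :: "('a \<Rightarrow> 'a) set \<Rightarrow> ('a \<Rightarrow> 'a) set"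
  for \<Gamma> :: "('a \<Rightarrow> 'a) set" where
  generator: "g \<in> \<Gamma> \<Longrightarrow> g \<in> semigroup_generated \<Gamma>"
| comp: "g \<in> semigroup_generated \<Gamma> \<Longrightarrow> h \<in> semigroup_generated \<Gamma> \<Longrightarrow>
    g \<circ> h \<in> semigroup_generated \<Gamma>"

definition equicontinuous_on :: "'a::metric_space set \<Rightarrow> ('a \<Rightarrow> 'b::metric_space) set \<Rightarrow> bool" where
  "equicontinuous_on U G \<longleftrightarrow>
     (\<forall>x\<in>U. \<forall>e>0. \<exists>d>0. \<forall>y\<in>U. dist x y < d \<longrightarrow> (\<forall>g\<in>G. dist (g x) (g y) < e))"

definition Fatou :: "(riemann_sphere \<Rightarrow> riemann_sphere) set \<Rightarrow> riemann_sphere set" where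
  "Fatou G = {z. \<exists>U. open U \<and> z \<in> U \<and> equicontinuous_on U G}"

definition Julia :: "(riemann_sphere \<Rightarrow> riemann_sphere) set \<Rightarrow> riemann_sphere set" where
  "Julia G = - Fatou G"

definition Julia_ker :: "(riemann_sphere \<Rightarrow> riemann_sphere) set \<Rightarrow> riemann_sphere set" where
  "Julia_ker G = (\<Inter>g\<in>G. g -` Julia G)"

text \<open>\<open>\<complex>\<^sup>n\<close>, with the dimension as a term: its points are the functions
  \<open>nat \<Rightarrow> complex\<close> that are \<^const>\<open>undefined\<close> off \<open>{..<n}\<close>.\<close>

definition Cn :: "nat \<Rightarrow> (nat \<Rightarrow> complex) topology" where
  "Cn n = product_topology (\<lambda>_. euclidean) {..<n}"

text \<open>Holomorphic functions of several variables on an open set: continuous, and holomorphic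
  in each variable separately.\<close>

definition holomorphic_Cn :: "nat \<Rightarrow> (nat \<Rightarrow> complex) set \<Rightarrow> ((nat \<Rightarrow> complex) \<Rightarrow> complex) \<Rightarrow> bool" where
  "holomorphic_Cn n W f \<longleftrightarrow>
     openin (Cn n) W \<and> continuous_map (subtopology (Cn n) W) euclidean f \<and>
     (\<forall>x\<in>W. \<forall>i<n. (\<lambda>t. f (x(i := t))) holomorphic_on {t. x(i := t) \<in> W})"

text \<open>An atlas is a set of pairs of a chart domain and a chart map; only the values of the
  chart map on the chart domain matter.\<close>

record 'a charted_space =
  cs_top :: "'a topology"
  cs_dim :: nat
  cs_atlas :: "('a set \<times> ('a \<Rightarrow> nat \<Rightarrow> complex)) set"

text \<open>Manifolds are taken to be connected, as is needed for a nonconstant holomorphic map to be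
  nonconstant near some point.\<close>

locale complex_manifold =
  fixes M :: "'a charted_space"
  assumes Hausdorff: "Hausdorff_space (cs_top M)"
    and second_countable: "second_countable (cs_top M)"
    and connected: "connected_space (cs_top M)"
    and charts_cover: "(\<Union>(U, \<phi>)\<in>cs_atlas M. U) = topspace (cs_top M)"
    and chart_open: "(U, \<phi>) \<in> cs_atlas M \<Longrightarrow> openin (cs_top M) U"
    and chart_image_open: "(U, \<phi>) \<in> cs_atlas M \<Longrightarrow> openin (Cn (cs_dim M)) (\<phi> ` U)"
    and chart_homeomorphic: "(U, \<phi>) \<in> cs_atlas M \<Longrightarrow>
      homeomorphic_map (subtopology (cs_top M) U) (subtopology (Cn (cs_dim M)) (\<phi> ` U)) \<phi>"
    and chart_transition: "(U, \<phi>) \<in> cs_atlas M \<Longrightarrow> (V, \<psi>) \<in> cs_atlas M \<Longrightarrow> i < cs_dim M \<Longrightarrow>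
      holomorphic_Cn (cs_dim M) (\<phi> ` (U \<inter> V)) (\<lambda>x. \<psi> (inv_into U \<phi> x) i)"

definition holomorphic_map :: "'a charted_space \<Rightarrow> 'b charted_space \<Rightarrow> ('a \<Rightarrow> 'b) \<Rightarrow> bool" where
  "holomorphic_map M N f \<longleftrightarrow>
     continuous_map (cs_top M) (cs_top N) f \<and>
     (\<forall>(U, \<phi>)\<in>cs_atlas M. \<forall>(V, \<psi>)\<in>cs_atlas N. \<forall>i<cs_dim N.
        holomorphic_Cn (cs_dim M) (\<phi> ` (U \<inter> f -` V)) (\<lambda>x. \<psi> (f (inv_into U \<phi> x)) i))"

definition prod_charted :: "'a charted_space \<Rightarrow> 'b charted_space \<Rightarrow> ('a \<times> 'b) charted_space" where
  "prod_charted M N =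
     \<lparr> cs_top = prod_topology (cs_top M) (cs_top N),
       cs_dim = cs_dim M + cs_dim N,
       cs_atlas = {(U \<times> V, \<lambda>(x, y). \<lambda>i\<in>{..<cs_dim M + cs_dim N}.
                      if i < cs_dim M then \<phi> x i else \<psi> y (i - cs_dim M)) | U \<phi> V \<psi>.
                    (U, \<phi>) \<in> cs_atlas M \<and> (V, \<psi>) \<in> cs_atlas N} \<rparr>"

text \<open>The charts of the sphere are \<open>z\<close> on \<open>\<complex>\<close> and \<open>1/z\<close> on the complement of \<open>0\<close>.\<close>

definition sphere_charted :: "riemann_sphere charted_space" where
  "sphere_charted =
     \<lparr> cs_top = euclidean,
       cs_dim = 1,
       cs_atlas = {(- {Infty}, \<lambda>p. \<lambda>i\<in>{..<1}. case p of Fin z \<Rightarrow> z | Infty \<Rightarrow> undefined),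
                   (- {Fin 0}, \<lambda>p. \<lambda>i\<in>{..<1}. case p of Fin z \<Rightarrow> 1 / z | Infty \<Rightarrow> 0)} \<rparr>"

definition holomorphic_family_rational ::
  "'l charted_space \<Rightarrow> ('l \<Rightarrow> riemann_sphere \<Rightarrow> riemann_sphere) \<Rightarrow> bool" where
  "holomorphic_family_rational \<Lambda> g \<longleftrightarrow>
     complex_manifold \<Lambda> \<and> (\<forall>l\<in>topspace (cs_top \<Lambda>). rational_map (g l)) \<and>
     holomorphic_map (prod_charted sphere_charted \<Lambda>) sphere_charted (\<lambda>(z, l). g l z)"

definition holomorphic_family_polynomial ::
  "'l charted_space \<Rightarrow> ('l \<Rightarrow> riemann_sphere \<Rightarrow> riemann_sphere) \<Rightarrow> bool" where
  "holomorphic_family_polynomial \<Lambda> g \<longleftrightarrow>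
     holomorphic_family_rational \<Lambda> g \<and> (\<forall>l\<in>topspace (cs_top \<Lambda>). polynomial_map (g l))"

text \<open>HOL cannot quantify over all manifolds inside a formula, so the type of the points of the
  parameter manifolds is an argument. A statement for all types \<open>'l\<close> covers arbitrary families
  of manifolds, as these embed in a sufficiently large type.\<close>

definition admissible :: "'l itself \<Rightarrow> (riemann_sphere \<Rightarrow> riemann_sphere) set \<Rightarrow> bool" where
  "admissible (_ :: 'l itself) Y \<longleftrightarrow>
     (\<forall>z0. \<exists>(\<Lambda> :: 'l charted_space) g.
        holomorphic_family_polynomial \<Lambda> g \<and>
        g ` topspace (cs_top \<Lambda>) \<subseteq> Y \<and>
        \<not> (\<lambda>l. g l (Fin z0)) constant_on topspace (cs_top \<Lambda>))"

end

theory Submission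
  imports Defs "HOL-Complex_Analysis.Complex_Analysis"
begin

text \<open>Relative compactness gives a common radius \<open>R\<close> such that no element of \<open>G\<close> decreases the
  modulus of a point outside the disc of radius \<open>R\<close>. In the coordinate \<open>1/z\<close> the semigroup is
  therefore uniformly bounded near \<open>\<infinity>\<close>, so the Julia set lies in that disc. The kernel Julia set is
  forward invariant. If it contained \<open>z\<^sub>0\<close>, then by admissibility and the open mapping theorem it
  would contain an open set of points \<open>g\<^sub>\<lambda>(z\<^sub>0)\<close>, all of which lie in the Julia set. But \<open>G\<close> maps
  that open set into the disc, so by Cauchy's estimates it is equicontinuous there.\<close>

lemma stereo_dist_sq: "(dist (stereo p) (stereo q))\<^sup>2 = 2 - 2 * cos (dist p q)"
proof -
  have "cos (dist p q) = stereo p \<bullet> stereo q"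
    unfolding dist_riemann_sphere_def by (intro cos_arccos stereo_inner_bounds)
  then show ?thesis
    by (simp add: dist_norm power2_norm_eq_inner inner_diff_left inner_diff_right
        stereo_inner_self inner_commute)
qed

lemma continuous_stereo: "continuous_on UNIV stereo"
proof -
  have "isCont stereo p" for p
  proof -
    have "((\<lambda>q. sqrt (2 - 2 * cos (dist q p))) \<longlongrightarrow> sqrt (2 - 2 * cos (dist p p))) (at p)"
      by (intro tendsto_intros)
    moreover have "sqrt (2 - 2 * cos (dist q p)) = dist (stereo q) (stereo p)" for q
      by (metis stereo_dist_sq real_sqrt_abs abs_of_nonneg zero_le_dist)
    ultimately have "((\<lambda>q. dist (stereo q) (stereo p)) \<longlongrightarrow> 0) (at p)" by simp
    then show ?thesis unfolding isCont_def by (subst tendsto_dist_iff)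
  qed
  then show ?thesis by (simp add: continuous_at_imp_continuous_on)
qed

lemma continuous_Fin: "continuous_on UNIV Fin"
proof -
  have "isCont Fin z" for z
  proof -
    have c: "isCont (\<lambda>w. stereo (Fin w)) z"
      by (auto intro!: continuous_intros simp: add_nonneg_eq_0_iff)
    have "((\<lambda>w. arccos (stereo (Fin w) \<bullet> stereo (Fin z)))
        \<longlongrightarrow> arccos (stereo (Fin z) \<bullet> stereo (Fin z))) (at z)"
    proof (rule continuous_on_tendsto_compose[OF continuous_on_arccos'])
      show "((\<lambda>w. stereo (Fin w) \<bullet> stereo (Fin z)) \<longlongrightarrow> stereo (Fin z) \<bullet> stereo (Fin z)) (at z)"
        using c unfolding isCont_def by (intro tendsto_intros)
    qed (use stereo_inner_bounds in \<open>auto intro!: always_eventually simp del: stereo.simps\<close>)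
    then have "((\<lambda>w. dist (Fin w) (Fin z)) \<longlongrightarrow> 0) (at z)"
      by (simp add: dist_riemann_sphere_def stereo_inner_self del: stereo.simps)
    then show ?thesis unfolding isCont_def by (subst tendsto_dist_iff)
  qed
  then show ?thesis by (simp add: continuous_at_imp_continuous_on)
qed

lemma one_minus_snd_stereo: "1 - snd (stereo (Fin z)) = 2 / (1 + (cmod z)\<^sup>2)"
proof -
  have "1 + (cmod z)\<^sup>2 > 0" by (simp add: add_pos_nonneg)
  then show ?thesis by (simp add: field_simps)
qed

lemma open_Fin_image:
  assumes "open S"
  shows "open (Fin ` S)"
proof -
  define h where "h p = (1 / (1 - snd (stereo p))) *\<^sub>R fst (stereo p)" for p
  define A where "A = {p. snd (stereo p) \<noteq> 1}"
  have pos: "1 + (cmod z)\<^sup>2 > 0" for z by (simp add: add_pos_nonneg)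
  have nz: "1 + (cmod z)\<^sup>2 \<noteq> 0" for z using pos[of z] by simp
  have fin: "h (Fin z) = z" "Fin z \<in> A" for z
    using nz[of z] one_minus_snd_stereo[of z]
    unfolding h_def A_def by (simp_all del: stereo.simps(1)) (simp_all add: field_simps)
  have infty: "Infty \<notin> A" by (simp add: A_def)
  have "open A" unfolding A_def
    by (intro open_Collect_neq continuous_intros continuous_on_snd continuous_stereo)
  moreover have "continuous_on A h" unfolding h_def
    by (intro continuous_intros continuous_on_subset[OF continuous_stereo]) (auto simp: A_def)
  ultimately have "open (h -` S \<inter> A)" using assms continuous_on_open_vimage by blast
  moreover have "h -` S \<inter> A = Fin ` S"
  proof (rule set_eqI)
    show "p \<in> h -` S \<inter> A \<longleftrightarrow> p \<in> Fin ` S" for p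
      by (cases p) (use fin infty in auto)
  qed
  ultimately show ?thesis by simp
qed

lemma dist_Fin_Infty_le_iff: "dist (Fin w) Infty \<le> dist (Fin z) Infty \<longleftrightarrow> cmod z \<le> cmod w"
proof -
  have e: "stereo (Fin u) \<bullet> stereo Infty = 1 - 2 / (1 + (cmod u)\<^sup>2)" for u
    using one_minus_snd_stereo[of u] by (simp add: inner_prod_def)
  have pos: "1 + (cmod u)\<^sup>2 > 0" for u by (simp add: add_pos_nonneg)
  have "dist (Fin w) Infty \<le> dist (Fin z) Infty
      \<longleftrightarrow> stereo (Fin z) \<bullet> stereo Infty \<le> stereo (Fin w) \<bullet> stereo Infty"
    unfolding dist_riemann_sphere_def
    by (intro arccos_le_mono abs_stereo_inner_le)
  also have "\<dots> \<longleftrightarrow> cmod z \<le> cmod w"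
    unfolding e using pos[of z] pos[of w]
    by (simp add: frac_le_eq divide_le_cancel field_simps)
  finally show ?thesis .
qed

fun sphere_inv :: "riemann_sphere \<Rightarrow> riemann_sphere" where
  "sphere_inv (Fin z) = (if z = 0 then Infty else Fin (1 / z))"
| "sphere_inv Infty = Fin 0"

lemma sphere_inv_inv [simp]: "sphere_inv (sphere_inv p) = p"
  by (cases p) auto

lemma stereo_sphere_inv:
  "stereo (sphere_inv p) = (cnj (fst (stereo p)), - snd (stereo p))"
proof (cases p)
  case (Fin z)
  show ?thesis
  proof (cases "z = 0")
    case False
    define r where "r = cmod z"
    have r: "r\<^sup>2 > 0" "1 + r\<^sup>2 > 0" using False by (simp_all add: r_def add_pos_nonneg)
    have inv: "1 / z = (1 / r\<^sup>2) *\<^sub>R cnj z"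
      using False complex_div_cnj[of 1 z] by (simp add: r_def scaleR_conv_of_real)
    have "2 / (1 + (1 / r)\<^sup>2) * (1 / r\<^sup>2) = 2 / (1 + r\<^sup>2)"
      using r by (simp add: power_divide divide_simps)
    then have "(2 / (1 + (1 / r)\<^sup>2)) *\<^sub>R (1 / z) = (2 / (1 + r\<^sup>2)) *\<^sub>R cnj z"
      unfolding inv by (metis scaleR_scaleR)
    moreover have "cnj ((2 / (1 + r\<^sup>2)) *\<^sub>R z) = (2 / (1 + r\<^sup>2)) *\<^sub>R cnj z"
      by simp
    moreover have "((1 / r)\<^sup>2 - 1) / ((1 / r)\<^sup>2 + 1) = - ((r\<^sup>2 - 1) / (r\<^sup>2 + 1))"
      using r by (simp add: power_divide divide_simps)
    moreover have "cmod (1 / z) = 1 / r" by (simp add: norm_divide r_def)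
    ultimately show ?thesis using Fin False
      by (simp only: r_def[symmetric] sphere_inv.simps if_False fst_conv snd_conv stereo.simps)
  qed (use Fin in simp)
qed (simp add: zero_prod_def)

lemma dist_sphere_inv [simp]: "dist (sphere_inv p) (sphere_inv q) = dist p q"
  by (simp add: dist_riemann_sphere_def stereo_sphere_inv inner_prod_def inner_complex_def)

lemma Fatou_sphere_inv_conj:
  assumes "p \<in> Fatou ((\<lambda>g. sphere_inv \<circ> g \<circ> sphere_inv) ` G)"
  shows "sphere_inv p \<in> Fatou G"
proof -
  obtain U where U: "open U" "p \<in> U"
    "equicontinuous_on U ((\<lambda>g. sphere_inv \<circ> g \<circ> sphere_inv) ` G)"
    using assms by (auto simp: Fatou_def)
  have "continuous_on UNIV sphere_inv"
    by (auto simp: continuous_on_iff)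
  then have "open (sphere_inv -` U)" using U(1) by (simp add: open_vimage)
  moreover have "equicontinuous_on (sphere_inv -` U) G"
    unfolding equicontinuous_on_def
  proof (intro ballI allI impI)
    fix y and e :: real assume "y \<in> sphere_inv -` U" and e: "0 < e"
    then obtain d where d: "d > 0" and
      *: "\<And>z g. z \<in> U \<Longrightarrow> dist (sphere_inv y) z < d \<Longrightarrow> g \<in> G \<Longrightarrow>
        dist (g y) (g (sphere_inv z)) < e"
      using U(3) unfolding equicontinuous_on_def by fastforce
    show "\<exists>d>0. \<forall>z\<in>sphere_inv -` U. dist y z < d \<longrightarrow> (\<forall>g\<in>G. dist (g y) (g z) < e)"
      using d *[of "sphere_inv _"] by (intro exI[of _ d]) auto
  qed
  ultimately show ?thesis using U(2) by (auto simp: Fatou_def)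
qed

text \<open>The bounded case of Montel's theorem, from the Cauchy estimate for the derivative.\<close>

lemma Fatou_if_uniformly_bounded:
  assumes "open S" "a \<in> S"
    and G: "\<And>g. g \<in> G \<Longrightarrow>
      \<exists>f. f holomorphic_on S \<and> (\<forall>z\<in>S. g (Fin z) = Fin (f z) \<and> cmod (f z) \<le> M)"
  shows "Fin a \<in> Fatou G"
proof -
  obtain r0 where r0: "r0 > 0" "ball a r0 \<subseteq> S" using assms open_contains_ball by blast
  define r where "r = r0 / 2"
  have r: "r > 0" using r0 by (simp add: r_def)
  have lip: "cmod (f z - f w) \<le> (\<bar>M\<bar> + 1) / r * cmod (z - w)"
    if f: "f holomorphic_on S" "\<And>z. z \<in> S \<Longrightarrow> cmod (f z) \<le> M" and zw: "z \<in> ball a r" "w \<in> ball a r"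
    for f z w
  proof (rule field_differentiable_bound[of "ball a r" f "deriv f"])
    fix u assume u: "u \<in> ball a r"
    have sub: "cball u r \<subseteq> S"
    proof
      fix x assume "x \<in> cball u r"
      then have "dist a x < r0" using u dist_triangle[of a x u] by (simp add: r_def)
      then show "x \<in> S" using r0 by auto
    qed
    have uS: "u \<in> S" using sub r by auto
    show "(f has_field_derivative deriv f u) (at u within ball a r)"
      using f(1) \<open>open S\<close> uS holomorphic_derivI by blast
    have "cmod ((deriv ^^ 1) f u) \<le> fact 1 * (\<bar>M\<bar> + 1) / r ^ 1"
    proof (rule Cauchy_higher_deriv_bound[where y = 0])
      show "continuous_on (cball u r) f"
        using f(1) sub by (blast intro: holomorphic_on_imp_continuous_on holomorphic_on_subset)
      have "cmod (f w) < \<bar>M\<bar> + 1" if "w \<in> S" for w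
        using f(2)[OF that] by linarith
      then show "f w \<in> ball 0 (\<bar>M\<bar> + 1)" if "w \<in> ball u r" for w
        using that sub by (auto simp: subset_iff)
      show "f holomorphic_on ball u r"
        using f(1) sub ball_subset_cball by (blast intro: holomorphic_on_subset)
    qed (use r in auto)
    then show "cmod (deriv f u) \<le> (\<bar>M\<bar> + 1) / r" by simp
  qed (use zw in auto)
  have "equicontinuous_on (Fin ` ball a r) G"
    unfolding equicontinuous_on_def
  proof (intro ballI allI impI)
    fix x and e :: real assume x: "x \<in> Fin ` ball a r" and e: "0 < e"
    then obtain b where b: "x = Fin b" "b \<in> ball a r" by blast
    have "uniformly_continuous_on (cball 0 M) Fin"
      by (intro compact_uniformly_continuous continuous_on_subset[OF continuous_Fin]) auto
    then obtain \<eta> where eta: "\<eta> > 0"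
      "\<And>u v. u \<in> cball 0 M \<Longrightarrow> v \<in> cball 0 M \<Longrightarrow> dist v u < \<eta> \<Longrightarrow> dist (Fin v) (Fin u) < e"
      using e unfolding uniformly_continuous_on_def by metis
    define C where "C = (\<bar>M\<bar> + 1) / r"
    have C: "C > 0" using r by (simp add: C_def add_nonneg_pos)
    have "open (Fin ` ball b (\<eta> / C))" by (intro open_Fin_image) auto
    moreover have "x \<in> Fin ` ball b (\<eta> / C)" using b C eta by auto
    ultimately obtain d where d: "d > 0" "ball x d \<subseteq> Fin ` ball b (\<eta> / C)"
      using open_contains_ball by blast
    have "dist (g x) (g y) < e" if y: "y \<in> Fin ` ball a r" "dist x y < d" and g: "g \<in> G" for y g
    proof -
      obtain c where c: "y = Fin c" "c \<in> ball a r" using y by blast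
      have "y \<in> Fin ` ball b (\<eta> / C)" using y d by auto
      then have cb: "cmod (b - c) < \<eta> / C" using c by (auto simp: dist_norm)
      obtain f where f: "f holomorphic_on S" "\<And>z. z \<in> S \<Longrightarrow> g (Fin z) = Fin (f z)"
        "\<And>z. z \<in> S \<Longrightarrow> cmod (f z) \<le> M"
        using G[OF g] by blast
      have S: "b \<in> S" "c \<in> S" using b c r0 r by (auto simp: r_def subset_iff)
      have "cmod (f b - f c) \<le> C * cmod (b - c)"
        using lip[OF f(1,3) b(2) c(2)] by (simp add: C_def)
      also have "\<dots> < \<eta>" using cb C by (simp add: field_simps)
      finally have "dist (Fin (f b)) (Fin (f c)) < e"
        using f(3) S by (intro eta(2)) (auto simp: dist_norm)
      then show ?thesis using f(2) S b c by simp
    qed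
    then show "\<exists>d>0. \<forall>y\<in>Fin ` ball a r. dist x y < d \<longrightarrow> (\<forall>g\<in>G. dist (g x) (g y) < e)"
      using d(1) by blast
  qed
  moreover have "open (Fin ` ball a r)" by (intro open_Fin_image) auto
  ultimately show ?thesis using r by (auto simp: Fatou_def)
qed

text \<open>The maximum principle is applied to \<open>z\<^sup>2 / p z\<close> in the coordinate \<open>1 / z\<close>.\<close>

lemma poly_bound_from_max_principle:
  fixes p :: "complex poly"
  assumes deg: "degree p \<ge> 2" and R: "R > 0"
    and ge: "\<And>z. cmod z \<ge> R \<Longrightarrow> cmod (poly p z) \<ge> R" and z: "cmod z \<ge> R"
  shows "cmod (poly p z) \<ge> cmod z"
proof -
  define n where "n = degree p - 2"
  have n: "degree p = n + 2" using deg by (simp add: n_def)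
  define q where "q = reflect_poly p"
  define h where "h w = w ^ n / poly q w" for w
  have q: "poly q w = w ^ n * w\<^sup>2 * poly p (inverse w)" if "w \<noteq> 0" for w
    using that unfolding q_def by (simp add: poly_reflect_poly_nz n power_add power2_eq_square)
  have inv: "cmod (inverse w) \<ge> R" if "w \<noteq> 0" "cmod w \<le> 1 / R" for w
  proof -
    have "R \<le> 1 / cmod w" using that R by (simp add: field_simps)
    then show ?thesis by (simp add: inverse_eq_divide norm_divide)
  qed
  have q0: "poly q w \<noteq> 0" if "cmod w \<le> 1 / R" for w
  proof (cases "w = 0")
    case True
    then show ?thesis using deg by (auto simp: q_def)
  next
    case False
    have "poly p (inverse w) \<noteq> 0" using ge[OF inv[OF False that]] R by auto
    then show ?thesis using False by (simp add: q)
  qed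
  have h: "cmod (h w) = 1 / ((cmod w)\<^sup>2 * cmod (poly p (inverse w)))" if "w \<noteq> 0" for w
    using that by (simp add: h_def q norm_divide norm_mult norm_power)
  have hol: "h holomorphic_on cball 0 (1 / R)"
    unfolding h_def using q0 by (intro holomorphic_intros) auto
  have "cmod (h (1 / z)) \<le> R"
  proof (rule maximum_modulus_frontier[of h "cball 0 (1 / R)"])
    show "h holomorphic_on interior (cball 0 (1 / R))"
      using hol by (rule holomorphic_on_subset) (rule interior_subset)
    show "continuous_on (closure (cball 0 (1 / R))) h"
      using hol by (simp add: holomorphic_on_imp_continuous_on)
    show "1 / z \<in> cball 0 (1 / R)" using z R by (simp add: norm_divide frac_le)
    fix w assume "w \<in> frontier (cball 0 (1 / R) :: complex set)"
    then have w: "cmod w = 1 / R" using R by simp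
    then have w0: "w \<noteq> 0" using R by auto
    have c: "R \<le> cmod (poly p (inverse w))" using ge[OF inv] w w0 by simp
    have "R * R / cmod (poly p (inverse w)) \<le> R * R / R"
      using c R by (intro divide_left_mono mult_pos_pos) auto
    then show "cmod (h w) \<le> R"
      using R unfolding h[OF w0] w by (simp add: power2_eq_square)
  qed auto
  moreover have z0: "z \<noteq> 0" "poly p z \<noteq> 0" using z R ge[OF z] by auto
  ultimately have "(cmod z)\<^sup>2 \<le> R * cmod (poly p z)"
    using h[of "1 / z"] by (simp add: norm_divide field_simps)
  also have "\<dots> \<le> cmod z * cmod (poly p z)" using z by (intro mult_right_mono) auto
  finally show ?thesis using z0 by (simp add: power2_eq_square)
qed

lemma poly_bound_near:
  assumes "f \<in> \<P>"
  shows "\<exists>e>0. \<exists>R>0. \<forall>p z. degree p \<ge> 2 \<longrightarrow> \<kappa> f (poly_map p) < e \<longrightarrow>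
    cmod z \<ge> R \<longrightarrow> cmod (poly p z) \<ge> cmod z"
proof -
  obtain q where q: "f = poly_map q" "degree q \<ge> 2" using assms by (auto simp: \<P>_def)
  have "((\<lambda>z. poly [:0, 1:] z / poly q z) \<longlongrightarrow> 0) at_infinity"
    using q by (intro poly_divide_tendsto_0_at_infinity) auto
  then have "\<forall>\<^sub>F z in at_infinity. cmod (z / poly q z) < 1 / 2 \<and> poly q z \<noteq> 0"
    using tendstoD[of "\<lambda>z. z / poly q z" 0 at_infinity "1/2"] q
    by (intro eventually_conj filterlim_at_infinity_imp_eventually_ne[OF filterlim_poly_at_infinity])
      (auto simp: dist_norm)
  then obtain R0 where R0: "\<And>z. cmod z \<ge> R0 \<Longrightarrow> cmod (z / poly q z) < 1 / 2 \<and> poly q z \<noteq> 0"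
    unfolding eventually_at_infinity by blast
  define R where "R = max 1 R0"
  have R: "R > 0" "R \<ge> R0" by (auto simp: R_def)
  have q2: "cmod (poly q z) \<ge> 2 * R" if "cmod z \<ge> R" for z
  proof -
    have "cmod z / cmod (poly q z) < 1 / 2" "cmod (poly q z) > 0"
      using R0[of z] that R by (auto simp: norm_divide)
    then have "2 * cmod z < cmod (poly q z)" by (simp add: pos_divide_less_eq)
    then show ?thesis using that by simp
  qed
  define e where "e = dist (Fin R) Infty - dist (Fin (2 * R)) Infty"
  have "e > 0" using R dist_Fin_Infty_le_iff[of R "2 * R"] by (simp add: e_def not_le norm_mult)
  moreover have "cmod (poly p z) \<ge> cmod z"
    if p: "degree p \<ge> 2" "\<kappa> f (poly_map p) < e" and z: "cmod z \<ge> R" for p z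
  proof (rule poly_bound_from_max_principle[OF p(1) R(1) _ z])
    fix w :: complex assume w: "cmod w \<ge> R"
    have "dist (Fin (poly q w)) (Fin (poly p w)) < e"
      using dist_le_\<kappa>[of f "Fin w" "poly_map p"] p(2) by (simp add: q poly_map_simps)
    moreover have "dist (Fin (poly q w)) Infty \<le> dist (Fin (2 * R)) Infty"
      using q2[OF w] R by (simp add: dist_Fin_Infty_le_iff norm_mult)
    ultimately have "dist (Fin (poly p w)) Infty \<le> dist (Fin R) Infty"
      using dist_triangle3[of "Fin (poly p w)" Infty "Fin (poly q w)"] by (simp add: e_def)
    then show "cmod (poly p w) \<ge> R" using R by (simp add: dist_Fin_Infty_le_iff)
  qed
  ultimately show ?thesis using R(1) by blast
qed

lemma relatively_compact_escape_radius:
  assumes "relatively_compactin \<P>_topology \<Gamma>"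
  obtains R where "R > 0"
    "\<And>p z. degree p \<ge> 2 \<Longrightarrow> poly_map p \<in> \<Gamma> \<Longrightarrow> cmod z \<ge> R \<Longrightarrow> cmod (poly p z) \<ge> cmod z"
proof -
  interpret Metric_space \<P> \<kappa> by (rule Metric_space_\<kappa>)
  define C where "C = mtopology closure_of \<Gamma>"
  have sub: "\<Gamma> \<subseteq> \<P>" and C: "compactin mtopology C"
    using assms by (auto simp: relatively_compactin_def \<P>_topology_def C_def)
  have GC: "\<Gamma> \<subseteq> C" unfolding C_def using sub by (intro closure_of_subset) auto
  have CP: "C \<subseteq> \<P>" unfolding C_def using closure_of_subset_topspace[of mtopology] by auto
  define good where "good e R f \<longleftrightarrow> (\<forall>p z. degree p \<ge> 2 \<longrightarrow> \<kappa> f (poly_map p) < e \<longrightarrow>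
    cmod z \<ge> R \<longrightarrow> cmod (poly p z) \<ge> cmod z)" for e R f
  have "\<exists>e R. e > 0 \<and> R > 0 \<and> good e R f" if "f \<in> \<P>" for f
    using poly_bound_near[OF that] unfolding good_def[symmetric] by blast
  then obtain e R where eR: "\<And>f. f \<in> \<P> \<Longrightarrow> e f > 0 \<and> R f > 0 \<and> good (e f) (R f) f"
    by metis
  have "\<exists>\<F>. finite \<F> \<and> \<F> \<subseteq> (\<lambda>f. mball f (e f)) ` C \<and> C \<subseteq> \<Union>\<F>"
  proof -
    have "f \<in> mball f (e f)" if "f \<in> C" for f using eR that CP centre_in_mball_iff by blast
    then have "C \<subseteq> \<Union>((\<lambda>f. mball f (e f)) ` C)" by blast
    moreover have "\<forall>U\<in>(\<lambda>f. mball f (e f)) ` C. openin mtopology U" by blast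
    ultimately show ?thesis using C unfolding compactin_def by blast
  qed
  then obtain \<F> where F: "finite \<F>" "\<F> \<subseteq> (\<lambda>f. mball f (e f)) ` C" "C \<subseteq> \<Union>\<F>"
    by blast
  obtain D where D0: "D \<subseteq> C" "finite D" "\<F> = (\<lambda>f. mball f (e f)) ` D"
    using finite_subset_image[OF F(1,2)] by blast
  then have D: "finite D" "D \<subseteq> C" "C \<subseteq> (\<Union>f\<in>D. mball f (e f))" using F(3) by auto
  define r where "r = Max (insert 1 (R ` D))"
  have "r \<ge> 1" unfolding r_def using D(1) by (intro Max_ge) auto
  moreover have "cmod (poly p z) \<ge> cmod z"
    if p: "degree p \<ge> 2" "poly_map p \<in> \<Gamma>" and z: "cmod z \<ge> r" for p z
  proof -
    have "poly_map p \<in> (\<Union>f\<in>D. mball f (e f))" using p(2) GC D(3) by blast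
    then obtain f where f: "f \<in> D" "\<kappa> f (poly_map p) < e f" by auto
    have "R f \<le> r" unfolding r_def using D(1) f(1) by (intro Max_ge) auto
    moreover have "good (e f) (R f) f" using eR f(1) D(2) CP by blast
    ultimately show ?thesis using f(2) p(1) z unfolding good_def by (meson order_trans)
  qed
  ultimately show ?thesis using that[of r] by fastforce
qed

lemma Fatou_exterior:
  assumes R: "R > 0"
    and G: "\<And>g. g \<in> G \<Longrightarrow> g Infty = Infty \<and>
      (\<exists>p. \<forall>z. g (Fin z) = Fin (poly p z) \<and> (cmod z \<ge> R \<longrightarrow> cmod (poly p z) \<ge> cmod z))"
    and a: "a \<in> ball 0 (1 / R)"
  shows "sphere_inv (Fin a) \<in> Fatou G"
proof (rule Fatou_sphere_inv_conj, rule Fatou_if_uniformly_bounded[OF _ a])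
  let ?S = "ball 0 (1 / R) :: complex set"
  fix g' assume "g' \<in> (\<lambda>g. sphere_inv \<circ> g \<circ> sphere_inv) ` G"
  then obtain g where g: "g \<in> G" "g' = sphere_inv \<circ> g \<circ> sphere_inv" by blast
  obtain p where p: "\<And>z. g (Fin z) = Fin (poly p z)"
    "\<And>z. cmod z \<ge> R \<Longrightarrow> cmod (poly p z) \<ge> cmod z" and gi: "g Infty = Infty"
    using G[OF g(1)] by metis
  define f where "f w = (if w = 0 then 0 else 1 / poly p (1 / w))" for w
  have pw: "cmod (poly p (1 / w)) \<ge> 1 / cmod w" "poly p (1 / w) \<noteq> 0"
    if "w \<in> ?S" "w \<noteq> 0" for w
  proof -
    have "cmod (1 / w) \<ge> R" using that R by (simp add: norm_divide field_simps)
    from p(2)[OF this] show *: "cmod (poly p (1 / w)) \<ge> 1 / cmod w" by (simp add: norm_divide)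
    show "poly p (1 / w) \<noteq> 0" using * that by auto
  qed
  have fw: "cmod (f w) \<le> cmod w" if "w \<in> ?S" for w
  proof (cases "w = 0")
    case False
    then have "1 / cmod (poly p (1 / w)) \<le> 1 / (1 / cmod w)"
      using pw[OF that False] by (intro divide_left_mono) auto
    then show ?thesis using False by (simp add: f_def norm_divide)
  qed (simp add: f_def)
  have "f holomorphic_on ?S"
  proof (rule no_isolated_singularity'[of "{0}"])
    have "(\<lambda>w. 1 / poly p (1 / w)) holomorphic_on ?S - {0}"
      using pw by (intro holomorphic_intros) auto
    then show "f holomorphic_on ?S - {0}"
      by (rule holomorphic_transform) (auto simp: f_def)
    fix z :: complex assume z: "z \<in> {0}"
    have "(f \<longlongrightarrow> 0) (at 0 within ?S)"
    proof (rule Lim_null_comparison)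
      show "\<forall>\<^sub>F w in at 0 within ?S. cmod (f w) \<le> cmod w"
        using fw by (auto simp: eventually_at_filter)
      show "(cmod \<longlongrightarrow> 0) (at 0 within ?S)"
        by (intro tendsto_norm_zero tendsto_ident_at)
    qed
    then show "(f \<longlongrightarrow> f z) (at z within ?S)" using z by (simp add: f_def)
  qed auto
  moreover have "g' (Fin w) = Fin (f w) \<and> cmod (f w) \<le> 1 / R" if "w \<in> ?S" for w
    using fw[OF that] that pw[OF that] by (auto simp: g(2) gi p(1) f_def)
  ultimately show "\<exists>f. f holomorphic_on ?S \<and>
      (\<forall>w\<in>?S. g' (Fin w) = Fin (f w) \<and> cmod (f w) \<le> 1 / R)" by blast
qed simp

lemma locally_constant_if_no_open_image:
  assumes W: "openin (Cn n) W" "x \<in> W"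
    and hol: "\<And>y i. y \<in> W \<Longrightarrow> i < n \<Longrightarrow> (\<lambda>t. F (y(i := t))) holomorphic_on {t. y(i := t) \<in> W}"
    and no_open: "\<And>S. open S \<Longrightarrow> S \<subseteq> F ` W \<Longrightarrow> S = {}"
  obtains B where "openin (Cn n) B" "x \<in> B" "B \<subseteq> W" "\<And>y. y \<in> B \<Longrightarrow> F y = F x"
proof -
  obtain U where U: "\<And>i. i < n \<Longrightarrow> open (U i)" "x \<in> Pi\<^sub>E {..<n} U" "Pi\<^sub>E {..<n} U \<subseteq> W"
    using W unfolding Cn_def openin_product_topology_alt by (metis lessThan_iff open_openin)
  have "\<exists>r>0. ball (x i) r \<subseteq> U i" if "i < n" for i
    using U(1)[OF that] U(2) that open_contains_ball by (auto simp: PiE_iff)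
  then obtain r where r: "\<And>i. i < n \<Longrightarrow> r i > 0 \<and> ball (x i) (r i) \<subseteq> U i" by metis
  define B where "B = Pi\<^sub>E {..<n} (\<lambda>i. ball (x i) (r i))"
  have BW: "B \<subseteq> W" using U(3) r unfolding B_def by (meson PiE_mono lessThan_iff order_trans)
  have xB: "x \<in> B" using U(2) r by (auto simp: B_def PiE_iff)
  have "F y = F x" if y: "y \<in> B" for y
  proof -
    define s where "s m = (\<lambda>i. if i < m then y i else x i)" for m
    have s: "s m \<in> B" if "m \<le> n" for m
      using y xB that by (auto simp: s_def B_def PiE_iff extensional_def)
    have "F (s m) = F x" if "m \<le> n" for m
      using that
    proof (induction m)
      case (Suc m)
      let ?D = "ball (x m) (r m)"
      let ?h = "\<lambda>t. F ((s m)(m := t))"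
      have m: "m < n" "s m \<in> W" using Suc.prems s[of m] BW by auto
      have D: "(s m)(m := t) \<in> B" if "t \<in> ?D" for t
        using that s[of m] m by (auto simp: B_def PiE_iff extensional_def)
      have hol_D: "?h holomorphic_on ?D"
        by (rule holomorphic_on_subset[OF hol[OF m(2,1)]]) (use D BW in auto)
      have "?h constant_on ?D"
      proof (rule ccontr)
        assume "\<not> ?h constant_on ?D"
        with hol_D have "open (?h ` ?D)" by (intro open_mapping_thm[of ?h ?D ?D]) auto
        moreover have "?h ` ?D \<subseteq> F ` W" using D BW by blast
        ultimately have "?h ` ?D = {}" by (rule no_open)
        then show False using r[OF m(1)] by auto
      qed
      moreover have "x m \<in> ?D" "y m \<in> ?D" using r m y by (auto simp: B_def PiE_iff)
      ultimately have "?h (y m) = ?h (x m)" by (auto simp: constant_on_def)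
      moreover have "(s m)(m := y m) = s (Suc m)" "(s m)(m := x m) = s m"
        by (auto simp: s_def fun_eq_iff less_Suc_eq)
      ultimately show ?case using Suc by simp
    qed (simp add: s_def)
    moreover have "s n = y" using y xB by (auto simp: s_def B_def fun_eq_iff PiE_iff extensional_def)
    ultimately show ?thesis by auto
  qed
  moreover have "openin (Cn n) B" unfolding B_def Cn_def
    by (subst openin_PiE) auto
  ultimately show ?thesis using that BW xB by blast
qed

lemma constant_if_locally_constant:
  assumes "connected_space X"
    and "\<And>x. x \<in> topspace X \<Longrightarrow> \<exists>N. openin X N \<and> x \<in> N \<and> (\<forall>y\<in>N. f y = f x)"
  shows "f constant_on topspace X"
proof (cases "topspace X = {}")
  case False
  then obtain a where a: "a \<in> topspace X" by blast
  define E where "E = {x \<in> topspace X. f x = f a}"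
  have level: "openin X {x \<in> topspace X. P (f x)}" for P
    unfolding openin_subopen[of X "{x \<in> topspace X. P (f x)}"]
  proof
    fix x assume "x \<in> {x \<in> topspace X. P (f x)}"
    then have x: "x \<in> topspace X" "P (f x)" by auto
    then obtain N where N: "openin X N" "x \<in> N" "\<forall>y\<in>N. f y = f x"
      using assms(2)[OF x(1)] by blast
    have "N \<subseteq> {x \<in> topspace X. P (f x)}"
    proof
      fix y assume "y \<in> N"
      then have "f y = f x" "y \<in> topspace X" using N(3) openin_subset[OF N(1)] by blast+
      then show "y \<in> {x \<in> topspace X. P (f x)}" using x by simp
    qed
    then show "\<exists>N. openin X N \<and> x \<in> N \<and> N \<subseteq> {x \<in> topspace X. P (f x)}" using N by blast
  qed
  have "topspace X - E = {x \<in> topspace X. f x \<noteq> f a}" by (auto simp: E_def)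
  then have "openin X E" "openin X (topspace X - E)"
    using level[of "\<lambda>y. y = f a"] level[of "\<lambda>y. y \<noteq> f a"] by (simp_all only: E_def)
  moreover from this have "closedin X E"
    unfolding closedin_def using openin_subset by blast
  ultimately have "E = {} \<or> E = topspace X"
    using assms(1) unfolding connected_space_clopen_in by blast
  then have "E = topspace X" using a by (auto simp: E_def)
  then show ?thesis unfolding constant_on_def E_def by blast
qed (simp add: constant_on_def)

lemma holomorphic_in_chart:
  assumes fam: "holomorphic_family_polynomial \<Lambda> g"
    and chart: "(V, \<psi>) \<in> cs_atlas \<Lambda>"
    and \<eta>: "\<And>l. l \<in> topspace (cs_top \<Lambda>) \<Longrightarrow> g l (Fin z0) = Fin (\<eta> l)"
    and x: "x \<in> \<psi> ` V" and i: "i < cs_dim \<Lambda>"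
  shows "(\<lambda>t. \<eta> (inv_into V \<psi> (x(i := t)))) holomorphic_on {t. x(i := t) \<in> \<psi> ` V}"
proof -
  interpret complex_manifold \<Lambda>
    using fam by (auto simp: holomorphic_family_polynomial_def holomorphic_family_rational_def)
  define n where "n = cs_dim \<Lambda>"
  define c where "c p = (\<lambda>i\<in>{..<1::nat}. case p of Fin z \<Rightarrow> z | Infty \<Rightarrow> undefined)" for p
  define \<Phi> where "\<Phi> = (\<lambda>(p, l). \<lambda>i\<in>{..<1 + n}. if i < 1 then c p i else \<psi> l (i - 1))"
  define U where "U = - {Infty}"
  define f where "f = (\<lambda>(z, l). g l z)"
  define A where "A = \<Phi> ` (U \<times> V \<inter> f -` U)"
  have "holomorphic_map (prod_charted sphere_charted \<Lambda>) sphere_charted f"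
    using fam by (simp add: f_def holomorphic_family_polynomial_def holomorphic_family_rational_def)
  moreover have dim: "cs_dim sphere_charted = 1" by (simp add: sphere_charted_def)
  moreover have cU: "(U, c) \<in> cs_atlas sphere_charted"
    by (auto simp: sphere_charted_def U_def c_def fun_eq_iff)
  moreover have "(U \<times> V, \<Phi>) \<in> cs_atlas (prod_charted sphere_charted \<Lambda>)"
    using cU chart unfolding prod_charted_def \<Phi>_def n_def charted_space.simps dim
    by blast
  moreover have "cs_dim (prod_charted sphere_charted \<Lambda>) = 1 + n"
    by (simp add: prod_charted_def dim n_def)
  ultimately have hol: "holomorphic_Cn (1 + n) A (\<lambda>x. c (f (inv_into (U \<times> V) \<Phi> x)) 0)"
    unfolding holomorphic_map_def A_def by fastforce
  have V: "V \<subseteq> topspace (cs_top \<Lambda>)" using chart_open[OF chart] by (rule openin_subset)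
  have inj: "inj_on \<psi> V"
    using chart_homeomorphic[OF chart] V
    by (simp add: homeomorphic_eq_everything_map Int_absorb1)
  have ext: "\<psi> l \<in> extensional {..<n}" if "l \<in> V" for l
    using openin_subset[OF chart_image_open[OF chart]] that
    by (auto simp: Cn_def n_def PiE_iff)
  have inj\<Phi>: "inj_on \<Phi> (U \<times> V)"
  proof (rule inj_onI, clarify)
    fix p l q l' assume *: "p \<in> U" "l \<in> V" "q \<in> U" "l' \<in> V" and eq: "\<Phi> (p, l) = \<Phi> (q, l')"
    have "c p 0 = c q 0" using fun_cong[OF eq, of 0] by (simp add: \<Phi>_def)
    then have "p = q" using * by (cases p; cases q) (auto simp: c_def U_def)
    moreover have "\<psi> l j = \<psi> l' j" for j
      using fun_cong[OF eq, of "Suc j"] ext[OF *(2)] ext[OF *(4)]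
      by (cases "j < n") (auto simp: \<Phi>_def extensional_def)
    then have "\<psi> l = \<psi> l'" by (simp add: fun_eq_iff)
    then have "l = l'" using inj * by (auto dest: inj_onD)
    ultimately show "p = q \<and> l = l'" by blast
  qed
  define k where "k y = (\<lambda>j\<in>{..<1 + n}. if j < 1 then z0 else y (j - 1))" for y :: "nat \<Rightarrow> complex"
  have k: "\<Phi> (Fin z0, l) = k (\<psi> l)" for l
    by (auto simp: \<Phi>_def k_def c_def fun_eq_iff)
  have upd: "(k y)(Suc i := t) = k (y(i := t))" for y t
    using i by (auto simp: k_def n_def fun_eq_iff)
  have kA: "k y \<in> A" "c (f (inv_into (U \<times> V) \<Phi> (k y))) 0 = \<eta> (inv_into V \<psi> y)"
    if y: "y \<in> \<psi> ` V" for y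
  proof -
    obtain l where l: "l \<in> V" "y = \<psi> l" using y by blast
    have "f (Fin z0, l) = Fin (\<eta> l)" using \<eta> l V by (auto simp: f_def)
    moreover have "(Fin z0, l) \<in> U \<times> V" using l by (simp add: U_def)
    moreover have "inv_into (U \<times> V) \<Phi> (k y) = (Fin z0, l)" "inv_into V \<psi> y = l"
      using inv_into_f_f[OF inj\<Phi> \<open>(Fin z0, l) \<in> U \<times> V\<close>] inv_into_f_f[OF inj l(1)]
      by (simp_all add: k l)
    ultimately show "k y \<in> A" "c (f (inv_into (U \<times> V) \<Phi> (k y))) 0 = \<eta> (inv_into V \<psi> y)"
      using k[of l] by (auto simp: A_def l U_def c_def image_iff intro!: bexI[of _ "(Fin z0, l)"])
  qed
  have "(\<lambda>t. c (f (inv_into (U \<times> V) \<Phi> ((k x)(Suc i := t)))) 0) holomorphic_on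
      {t. (k x)(Suc i := t) \<in> A}"
    using hol kA(1)[OF x] i unfolding holomorphic_Cn_def n_def by auto
  then have "(\<lambda>t. c (f (inv_into (U \<times> V) \<Phi> (k (x(i := t))))) 0) holomorphic_on
      {t. x(i := t) \<in> \<psi> ` V}"
    unfolding upd by (rule holomorphic_on_subset) (use kA(1) in auto)
  then show ?thesis by (rule holomorphic_transform) (use kA(2) in auto)
qed

lemma open_subset_image_family:
  assumes fam: "holomorphic_family_polynomial \<Lambda> g"
    and nonconst: "\<not> (\<lambda>l. g l (Fin z0)) constant_on topspace (cs_top \<Lambda>)"
  obtains S where "open S" "S \<noteq> {}" "Fin ` S \<subseteq> (\<lambda>l. g l (Fin z0)) ` topspace (cs_top \<Lambda>)"
proof (rule ccontr)
  assume "\<not> thesis"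
  then have no: "\<And>S. open S \<Longrightarrow> Fin ` S \<subseteq> (\<lambda>l. g l (Fin z0)) ` topspace (cs_top \<Lambda>) \<Longrightarrow> S = {}"
    using that by blast
  interpret complex_manifold \<Lambda>
    using fam by (auto simp: holomorphic_family_polynomial_def holomorphic_family_rational_def)
  define \<eta> where "\<eta> l = (case g l (Fin z0) of Fin w \<Rightarrow> w | Infty \<Rightarrow> undefined)" for l
  have \<eta>: "g l (Fin z0) = Fin (\<eta> l)" if l: "l \<in> topspace (cs_top \<Lambda>)" for l
  proof -
    obtain p where "g l = poly_map p"
      using fam l unfolding holomorphic_family_polynomial_def polynomial_map_def by blast
    then show ?thesis by (simp add: \<eta>_def poly_map_simps)
  qed
  have "\<eta> constant_on topspace (cs_top \<Lambda>)"
  proof (rule constant_if_locally_constant[OF connected])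
    fix l assume "l \<in> topspace (cs_top \<Lambda>)"
    then obtain V \<psi> where V: "(V, \<psi>) \<in> cs_atlas \<Lambda>" "l \<in> V" using charts_cover by blast
    note V_open = chart_open[OF V(1)]
    have Vsub: "V \<subseteq> topspace (cs_top \<Lambda>)" using V_open by (rule openin_subset)
    let ?n = "cs_dim \<Lambda>"
    have hm: "continuous_map (subtopology (cs_top \<Lambda>) V) (subtopology (Cn ?n) (\<psi> ` V)) \<psi>"
      using chart_homeomorphic[OF V(1)] by (rule homeomorphic_imp_continuous_map)
    have inj: "inj_on \<psi> V"
      using chart_homeomorphic[OF V(1)] Vsub
      by (simp add: homeomorphic_eq_everything_map Int_absorb1)
    obtain B where B: "openin (Cn ?n) B" "\<psi> l \<in> B" "B \<subseteq> \<psi> ` V"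
      "\<And>y. y \<in> B \<Longrightarrow> \<eta> (inv_into V \<psi> y) = \<eta> (inv_into V \<psi> (\<psi> l))"
    proof (rule locally_constant_if_no_open_image[OF chart_image_open[OF V(1)],
          of "\<psi> l" "\<lambda>y. \<eta> (inv_into V \<psi> y)"])
      fix S assume S: "open S" "S \<subseteq> (\<lambda>y. \<eta> (inv_into V \<psi> y)) ` \<psi> ` V"
      have "Fin ` S \<subseteq> (\<lambda>l. g l (Fin z0)) ` topspace (cs_top \<Lambda>)"
      proof clarify
        fix w assume "w \<in> S"
        then obtain l where "l \<in> V" "w = \<eta> l" using S(2) inj by auto
        then show "Fin w \<in> (\<lambda>l. g l (Fin z0)) ` topspace (cs_top \<Lambda>)"
          using \<eta> Vsub by (metis imageI subsetD)
      qed
      then show "S = {}" using no S(1) by blast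
    next
      show "\<psi> l \<in> \<psi> ` V" using V(2) by (rule imageI)
      show "(\<lambda>t. \<eta> (inv_into V \<psi> (y(i := t)))) holomorphic_on {t. y(i := t) \<in> \<psi> ` V}"
        if "y \<in> \<psi> ` V" "i < ?n" for y i
        using fam V(1) \<eta> that by (rule holomorphic_in_chart)
    qed blast
    define N where "N = {m \<in> V. \<psi> m \<in> B}"
    have "openin (subtopology (Cn ?n) (\<psi> ` V)) B"
      using B by (auto simp: openin_subtopology)
    then have "openin (subtopology (cs_top \<Lambda>) V) {m \<in> topspace (subtopology (cs_top \<Lambda>) V). \<psi> m \<in> B}"
      using hm openin_continuous_map_preimage by blast
    moreover have "{m \<in> topspace (subtopology (cs_top \<Lambda>) V). \<psi> m \<in> B} = N"
      using Vsub by (auto simp: N_def)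
    ultimately have "openin (cs_top \<Lambda>) N" using V_open openin_open_subtopology by metis
    moreover have "\<eta> m = \<eta> l" if "m \<in> N" for m
      using B(4)[of "\<psi> m"] that inj V by (auto simp: N_def)
    moreover have "l \<in> N" using V B by (simp add: N_def)
    ultimately show "\<exists>N. openin (cs_top \<Lambda>) N \<and> l \<in> N \<and> (\<forall>m\<in>N. \<eta> m = \<eta> l)" by blast
  qed
  then show False using nonconst \<eta> unfolding constant_on_def by metis
qed

theorem lemma3p56:
  fixes \<Gamma> G :: "(riemann_sphere \<Rightarrow> riemann_sphere) set"
  assumes "\<Gamma> \<subseteq> \<P>"
    and "relatively_compactin \<P>_topology \<Gamma>"
    and "admissible TYPE('l) \<Gamma>"
    and "G = semigroup_generated \<Gamma>"
  shows "Julia_ker G = {}"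
proof (rule ccontr)
  assume "Julia_ker G \<noteq> {}"
  then obtain p0 where p0: "p0 \<in> Julia_ker G" by blast
  have gen: "\<gamma> \<in> G" if "\<gamma> \<in> \<Gamma>" for \<gamma>
    using that assms(4) semigroup_generated.generator by blast
  have invariant: "\<gamma> p \<in> Julia_ker G" "\<gamma> p \<in> Julia G" if "\<gamma> \<in> \<Gamma>" "p \<in> Julia_ker G" for \<gamma> p
  proof -
    have "g (\<gamma> p) \<in> Julia G" if "g \<in> G" for g
    proof -
      have "g \<circ> \<gamma> \<in> G"
        using that gen[OF \<open>\<gamma> \<in> \<Gamma>\<close>] assms(4) semigroup_generated.comp by blast
      then show ?thesis using \<open>p \<in> Julia_ker G\<close> by (auto simp: Julia_ker_def)
    qed
    then show "\<gamma> p \<in> Julia_ker G" by (auto simp: Julia_ker_def)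
    show "\<gamma> p \<in> Julia G" using that gen by (auto simp: Julia_ker_def)
  qed
  obtain R where R: "R > 0"
    "\<And>p z. degree p \<ge> 2 \<Longrightarrow> poly_map p \<in> \<Gamma> \<Longrightarrow> cmod z \<ge> R \<Longrightarrow> cmod (poly p z) \<ge> cmod z"
    using relatively_compact_escape_radius[OF assms(2)] by metis
  have G: "g Infty = Infty \<and>
      (\<exists>p. \<forall>z. g (Fin z) = Fin (poly p z) \<and> (cmod z \<ge> R \<longrightarrow> cmod (poly p z) \<ge> cmod z))"
    if "g \<in> G" for g
    using that unfolding assms(4)
  proof (induction rule: semigroup_generated.induct)
    case (generator g)
    then obtain p where p: "g = poly_map p" "degree p \<ge> 2" using assms(1) by (auto simp: \<P>_def)
    then show ?case using R(2)[of p] generator by (auto simp: poly_map_simps)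
  next
    case (comp g h)
    then obtain p q where
      p: "\<And>z. g (Fin z) = Fin (poly p z)" "\<And>z. cmod z \<ge> R \<Longrightarrow> cmod (poly p z) \<ge> cmod z" and
      q: "\<And>z. h (Fin z) = Fin (poly q z)" "\<And>z. cmod z \<ge> R \<Longrightarrow> cmod (poly q z) \<ge> cmod z"
      by metis
    have "cmod (poly p (poly q z)) \<ge> cmod z" if "cmod z \<ge> R" for z
      using p(2)[of "poly q z"] q(2)[of z] that by linarith
    then show ?case using comp p(1) q(1) by (auto intro!: exI[of _ "pcompose p q"] simp: poly_pcompose)
  qed
  have Julia: "\<exists>z. p = Fin z \<and> cmod z \<le> R" if "p \<in> Julia G" for p
  proof (rule ccontr)
    assume *: "\<nexists>z. p = Fin z \<and> cmod z \<le> R"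
    obtain a where "p = sphere_inv (Fin a)" "a \<in> ball 0 (1 / R)"
    proof (cases p)
      case (Fin z)
      then have "cmod z > R" using * by auto
      moreover from this have "z \<noteq> 0" using R by auto
      ultimately show ?thesis using Fin R
        by (intro that[of "1 / z"]) (auto simp: norm_divide frac_less2)
    qed (use R in \<open>auto intro: that[of 0]\<close>)
    then have "p \<in> Fatou G" using Fatou_exterior[OF R(1) G] by blast
    then show False using that by (simp add: Julia_def)
  qed
  obtain \<gamma> where "\<gamma> \<in> \<Gamma>"
  proof -
    obtain \<Lambda> :: "'l charted_space" and g where "g ` topspace (cs_top \<Lambda>) \<subseteq> \<Gamma>"
      "\<not> (\<lambda>l. g l (Fin 0)) constant_on topspace (cs_top \<Lambda>)"
      using assms(3) unfolding admissible_def by blast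
    moreover from this have "topspace (cs_top \<Lambda>) \<noteq> {}" by (auto simp: constant_on_def)
    ultimately show ?thesis using that by blast
  qed
  then have "\<gamma> p0 \<in> Julia G" "\<gamma> Infty = Infty" using invariant(2) p0 G[OF gen] by auto
  then have "p0 \<noteq> Infty" using Julia[of "\<gamma> p0"] by auto
  then obtain z0 where z0: "p0 = Fin z0" by (cases p0) auto
  obtain \<Lambda> :: "'l charted_space" and g where fam: "holomorphic_family_polynomial \<Lambda> g"
    "g ` topspace (cs_top \<Lambda>) \<subseteq> \<Gamma>" "\<not> (\<lambda>l. g l (Fin z0)) constant_on topspace (cs_top \<Lambda>)"
    using assms(3) unfolding admissible_def by blast
  obtain S where S: "open S" "S \<noteq> {}" "Fin ` S \<subseteq> (\<lambda>l. g l (Fin z0)) ` topspace (cs_top \<Lambda>)"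
    using open_subset_image_family[OF fam(1,3)] by blast
  have SK: "Fin w \<in> Julia_ker G" "Fin w \<in> Julia G" if "w \<in> S" for w
  proof -
    have "Fin w \<in> (\<lambda>l. g l (Fin z0)) ` topspace (cs_top \<Lambda>)" using S(3) that by blast
    then obtain l where "l \<in> topspace (cs_top \<Lambda>)" "Fin w = g l p0" by (auto simp: z0)
    moreover from this have "g l \<in> \<Gamma>" using fam(2) by blast
    ultimately show "Fin w \<in> Julia_ker G" "Fin w \<in> Julia G" using invariant p0 by auto
  qed
  obtain a where a: "a \<in> S" using S(2) by blast
  have "Fin a \<in> Fatou G"
  proof (rule Fatou_if_uniformly_bounded[OF S(1) a, where M = R])
    fix h assume h: "h \<in> G"
    then obtain p where p: "\<And>z. h (Fin z) = Fin (poly p z)" using G by metis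
    have "cmod (poly p w) \<le> R" if "w \<in> S" for w
      using SK(1)[OF that] h Julia[of "h (Fin w)"] by (auto simp: Julia_ker_def p)
    then show "\<exists>f. f holomorphic_on S \<and> (\<forall>z\<in>S. h (Fin z) = Fin (f z) \<and> cmod (f z) \<le> R)"
      using p by (intro exI[of _ "poly p"]) (auto intro: holomorphic_intros)
  qed
  then show False using SK(2)[OF a] by (simp add: Julia_def)
qed

end
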